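(* Let $p$ be a prime, $q=p^s$, $A=\mathbb{F}_q[t]$, $K=\mathbb{F}_q(t)$, and $a,b\in\mathbb{Z}_+$. Let $m$ be the smallest nonnegative integer with $a\le p^m$ and $r_a=(q-1)p^m$. For $0\le j\le p^m-a$ let $i_j$ be the unique integer with $0\le i_j<q-1$ and $j+i_jp^m\equiv 0\pmod{q-1}$, and let $f_{a,j}=(-1)^j\binom{p^m-a}{j}\in\mathbb{F}_p$. Then in $K$ $$\Delta(a,b+r_a)-\Delta(a,b)=\sum_{j=0}^{p^m-a}f_{a,j}\,S_1\bigl(a+b+j+i_jp^m\bigr),$$ and the number of indices $j\in\{0,\dots,p^m-a\}$ with $f_{a,j}\neq0$ is exactly $t_a$.
   Context: For $s\in\mathbb{Z}$, $S_1(s)=\sum_n n^{-s}\in K$, summed over all monic $n\in A$ of degree $1$. For $a,b\in\mathbb{Z}_+$, $\Delta(a,b)=S_1(a)S_1(b)-S_1(a+b)$. Write $a-1=\sum_{l=0}^{m-1}a_lp^l$ with base-$p$ digits (exactly $m$ digits, leading zeros included); for $0\le j\le p-1$ let $\mu_j$ be the number of $l$ with $a_l=j$; $t_a=\prod_{j=0}^{p-2}(p-j)^{\mu_j}$ (empty product $=1$). *)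

theory Defs
  imports
    "HOL-Computational_Algebra.Computational_Algebra"
    "HOL-Number_Theory.Cong"
begin

text \<open>
  A finite field \<open>F\<close> is rendered as a type \<open>'a\<close> of class \<open>{field, finite}\<close>; then \<open>'a poly\<close>
  is \<open>F[t]\<close> and \<open>'a poly fract\<close> is \<open>F(t)\<close>.
\<close>

definition S1 :: "int \<Rightarrow> 'a::{field,finite} poly fract" where
  "S1 k = (\<Sum>n \<in> {n :: 'a poly. lead_coeff n = 1 \<and> degree n = 1}. to_fract n powi (- k))"

definition Delta :: "nat \<Rightarrow> nat \<Rightarrow> 'a::{field,finite} poly fract" where
  "Delta a b = S1 (int a) * S1 (int b) - S1 (int (a + b))"

definition min_exp :: "nat \<Rightarrow> nat \<Rightarrow> nat" where
  "min_exp p a = (LEAST m. a \<le> p ^ m)"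

definition r_shift :: "nat \<Rightarrow> nat \<Rightarrow> nat \<Rightarrow> nat" where
  "r_shift p q a = (q - 1) * p ^ min_exp p a"

text \<open>
  The index \<open>i\<^sub>j\<close>. The definite description is justified by \<open>i_index_ex1\<close> below.
\<close>
definition i_index :: "nat \<Rightarrow> nat \<Rightarrow> nat \<Rightarrow> nat \<Rightarrow> nat" where
  "i_index p q a j = (THE i. i < q - 1 \<and> [j + i * p ^ min_exp p a = 0] (mod (q - 1)))"

text \<open>
  The coefficient is an element of the prime field; it is read in \<open>'a\<close>, which
  contains \<open>F\<^sub>p\<close> as the set of images of the integers.
\<close>
definition f_coeff :: "nat \<Rightarrow> nat \<Rightarrow> nat \<Rightarrow> 'a::{field,finite}" where
  "f_coeff p a j = (-1) ^ j * of_nat ((p ^ min_exp p a - a) choose j)"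

text \<open>
  \<open>digit_count p a j\<close> is the number of digits equal to \<open>j\<close> among the lowest
  \<open>min_exp p a\<close> base-\<open>p\<close> digits of \<open>a - 1\<close>, leading zeros included.  Since
  \<open>a - 1 < p ^ min_exp p a\<close>, these are all its digits.
\<close>
definition digit_count :: "nat \<Rightarrow> nat \<Rightarrow> nat \<Rightarrow> nat" where
  "digit_count p a j = card {l. l < min_exp p a \<and> (a - 1) div p ^ l mod p = j}"

definition t_number :: "nat \<Rightarrow> nat \<Rightarrow> nat" where
  "t_number p a = (\<Prod>j = 0..p - 2. (p - j) ^ digit_count p a j)"

lemma i_index_ex1:
  fixes p q s a j :: nat
  assumes "prime p" and "q = p ^ s" and "s > 0"
  shows "\<exists>!i. i < q - 1 \<and> [j + i * p ^ min_exp p a = 0] (mod (q - 1))"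
proof -
  define P where "P = p ^ min_exp p a"
  have p2: "p \<ge> 2" using assms(1) by (rule prime_ge_2_nat)
  have "p ^ 1 \<le> p ^ s" using p2 assms(3) by (intro power_increasing) auto
  hence q2: "q \<ge> 2" using assms(2) p2 by simp
  have "coprime q (q - 1)" using q2 by (intro coprime_diff_one_right_nat) simp
  hence "coprime p (q - 1)" using assms(2,3) by simp
  hence cop: "coprime P (q - 1)" unfolding P_def by simp
  obtain u where u: "[P * u = 1] (mod (q - 1))" using cop cong_solve_coprime_nat by auto
  define N where "N = (q - 1) * j - j"
  have "(q - 1) * j \<ge> j" using q2 by (cases "q - 1") auto
  hence jN: "j + N = (q - 1) * j" unfolding N_def by simp
  define i where "i = (u * N) mod (q - 1)"
  have "[i = u * N] (mod (q - 1))" unfolding i_def by (rule cong_mod_left[THEN iffD2, OF cong_refl])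
  hence "[i * P = (u * N) * P] (mod (q - 1))" by (rule cong_scalar_right)
  hence "[i * P = (P * u) * N] (mod (q - 1))" by (simp only: mult_ac)
  also have "[(P * u) * N = 1 * N] (mod (q - 1))" using u by (rule cong_scalar_right)
  finally have "[i * P = N] (mod (q - 1))" by simp
  hence "[j + i * P = j + N] (mod (q - 1))" by (rule cong_add[OF cong_refl])
  hence ex: "[j + i * P = 0] (mod (q - 1))" unfolding jN by (simp add: cong_def)
  have lt: "i < q - 1" unfolding i_def using q2 by simp
  have "k = i" if "k < q - 1" "[j + k * P = 0] (mod (q - 1))" for k
  proof -
    have "[j + k * P = j + i * P] (mod (q - 1))" using that(2) ex by (simp add: cong_def)
    hence "[k = i] (mod (q - 1))" using cop
      by (simp only: cong_add_lcancel_nat cong_mult_rcancel_nat)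
    thus ?thesis using that(1) lt by (simp add: cong_def)
  qed
  thus ?thesis using ex lt unfolding P_def by blast
qed

end

theory Submission
  imports Defs "HOL-Number_Theory.Residues"
begin

text \<open>
  Put \<open>M = p\<^sup>m\<close> and index the pairs of distinct monic linear polynomials as \<open>(x - e, x)\<close> with
  \<open>e \<noteq> 0\<close> in \<open>F\<^sub>q\<close>. Since \<open>e\<^sup>q = e\<close> and \<open>(x - e)\<^sup>M = x\<^sup>M - e\<^sup>M\<close>, the factor \<open>x ^ ((q - 1) M) - 1\<close> equals
  \<open>(x - e)\<^sup>M\<close> times a geometric sum in \<open>x\<^sup>M\<close> and \<open>e\<^sup>M\<close>. It thereby clears the denominator of
  \<open>(x - e) ^ (- a)\<close>, and what is left, \<open>(x - e) ^ (M - a)\<close>, expands binomially. Summing over \<open>e\<close>, the power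
  sums \<open>\<Sum>e. e ^ (j + i M)\<close> are \<open>-1\<close> if \<open>q - 1\<close> divides the exponent and \<open>0\<close> otherwise, which
  selects \<open>i = i\<^sub>j\<close>.

  The base-\<open>p\<close> digits of \<open>M - a = (M - 1) - (a - 1)\<close> are the \<open>p - 1 - a\<^sub>l\<close>, so by Lucas's theorem exactly
  \<open>\<Prod>l. (p - a\<^sub>l)\<close> of the binomial coefficients of \<open>M - a\<close> are nonzero modulo \<open>p\<close>.
\<close>

section \<open>Power sums over the units of a finite field\<close>

lemma power_card_units_eq_1:
  fixes x :: "'a::{field,finite}"
  assumes "x \<noteq> 0"
  shows "x ^ (card (UNIV :: 'a set) - 1) = 1"
proof -
  \<comment> \<open>Multiplication by \<open>x\<close> permutes the units, so the product of all
    units is unchanged by it and, being nonzero, cancels.\<close>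
  have "(\<Prod>y\<in>UNIV-{0}. x * y) = x ^ (card (UNIV :: 'a set) - 1) * \<Prod>(UNIV-{0})"
    by (simp add: prod.distrib)
  moreover have "(\<Prod>y\<in>UNIV-{0}. x * y) = \<Prod>(UNIV-{0})"
    by (rule prod.reindex_bij_witness[of _ "\<lambda>y. y / x" "\<lambda>y. x * y"]) (use assms in auto)
  moreover have "\<Prod>(UNIV-{0::'a}) \<noteq> 0" by simp
  ultimately show ?thesis by simp
qed

lemma card_units_pos: "card (UNIV :: 'a::{field,finite} set) - 1 > 0"
proof -
  have "card {0, 1 :: 'a} \<le> card (UNIV :: 'a set)" by (intro card_mono) auto
  thus ?thesis by simp
qed

text \<open>If \<open>n\<close> divides \<open>k\<close>, every term is 1 and there are
  \<open>n\<close> of them, with \<open>n = -1\<close> in the field. Otherwise some unit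
  \<open>g\<close> has \<open>g ^ k\<close> different from 1, and the substitution of
  \<open>g * x\<close> for \<open>x\<close> multiplies the sum by \<open>g ^ k\<close>, so it
  vanishes.\<close>

lemma sum_power_units:
  fixes k :: nat
  defines "n \<equiv> card (UNIV :: 'a::{field,finite} set) - 1"
  shows "(\<Sum>x\<in>UNIV-{0::'a}. x ^ k) = (if n dvd k then -1 else 0)"
proof -
  have n: "n > 0" unfolding n_def by (rule card_units_pos)
  have card_units: "card (UNIV - {0::'a}) = n" by (simp add: n_def)
  have pow_n: "x ^ n = 1" if "x \<noteq> 0" for x :: 'a
    using that unfolding n_def by (rule power_card_units_eq_1)
  show ?thesis
  proof (cases "n dvd k")
    case True
    have "(\<Sum>x\<in>UNIV-{0::'a}. x ^ k) = (\<Sum>x\<in>UNIV-{0::'a}. 1)"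
      using True pow_n by (intro sum.cong) (auto simp: dvd_def power_mult)
    also have "\<dots> = of_nat n" using card_units by simp
    also have "of_nat n = (of_nat (card (UNIV :: 'a set)) - 1 :: 'a)"
      using n unfolding n_def by (subst of_nat_diff) auto
    also have "\<dots> = -1"
      using CHAR_dvd_CARD[where ?'a = 'a] by (simp add: of_nat_eq_0_iff_char_dvd)
    finally show ?thesis using True by simp
  next
    case False
    define r where "r = k mod n"
    have r: "0 < r" "r < n" using False n by (auto simp: r_def mod_greater_zero_iff_not_dvd)
    \<comment> \<open>Were there no such \<open>g\<close>, all \<open>n\<close> units would be roots
      of the polynomial \<open>X ^ r - 1\<close>, whose degree is at most
      \<open>r < n\<close>.\<close>
    have "\<exists>g::'a. g \<noteq> 0 \<and> g ^ k \<noteq> 1"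
    proof (rule ccontr)
      assume "\<not> ?thesis"
      hence *: "g ^ k = 1" if "g \<noteq> 0" for g :: 'a using that by blast
      have "g ^ r = 1" if "g \<noteq> 0" for g :: 'a
      proof -
        have "g ^ k = g ^ (n * (k div n) + r)" by (simp add: r_def)
        thus ?thesis using *[OF that] pow_n[OF that] by (simp add: power_add power_mult)
      qed
      hence "UNIV - {0} \<subseteq> {x. poly (Polynomial.monom 1 r - 1 :: 'a poly) x = 0}" by (auto simp: Polynomial.poly_monom)
      moreover have "Polynomial.coeff (Polynomial.monom 1 r - 1 :: 'a poly) r = 1"
        using r by simp
      hence nz: "(Polynomial.monom 1 r - 1 :: 'a poly) \<noteq> 0" by (metis Polynomial.coeff_0 zero_neq_one)
      ultimately have "n \<le> card {x. poly (Polynomial.monom 1 r - 1 :: 'a poly) x = 0}"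
        unfolding card_units[symmetric] by (intro card_mono) auto
      also have "\<dots> \<le> degree (Polynomial.monom 1 r - 1 :: 'a poly)" using nz by (rule card_poly_roots_bound)
      also have "\<dots> \<le> r" by (rule degree_diff_le) (simp_all add: Polynomial.degree_monom_le)
      finally show False using r by simp
    qed
    then obtain g :: 'a where g: "g \<noteq> 0" "g ^ k \<noteq> 1" by blast
    have "(\<Sum>x\<in>UNIV-{0}. x ^ k) = (\<Sum>x\<in>UNIV-{0}. (g * x) ^ k)"
      by (rule sum.reindex_bij_witness[of _ "\<lambda>x. g * x" "\<lambda>x. x / g"]) (use g in auto)
    also have "\<dots> = g ^ k * (\<Sum>x\<in>UNIV-{0}. x ^ k)"
      by (simp add: power_mult_distrib sum_distrib_left)
    finally show ?thesis using g False by simp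
  qed
qed

section \<open>Lucas's theorem and the count of binomial coefficients prime to
  \<open>p\<close>\<close>

lemma prime_add_choose_cong:
  fixes p n k :: nat
  assumes "prime p"
  shows "[(p + n) choose k = (n choose k) + (if p \<le> k then n choose (k - p) else 0)] (mod p)"
proof -
  have p: "p > 0" using assms by (rule prime_gt_0_nat)
  \<comment> \<open>\<open>f\<close> keeps the two terms of Vandermonde's sum that survive modulo
    \<open>p\<close>; for \<open>0 < i < p\<close> the factor \<open>p choose i\<close> is divisible
    by \<open>p\<close>.\<close>
  define f where "f i = (if i = 0 then n choose k else if i = p then n choose (k - p) else 0)" for i
  have "(p + n) choose k = (\<Sum>i\<le>k. (p choose i) * (n choose (k - i)))"
    by (simp add: vandermonde)
  also have "[\<dots> = (\<Sum>i\<le>k. f i)] (mod p)"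
  proof (rule cong_sum)
    fix i
    show "[(p choose i) * (n choose (k - i)) = f i] (mod p)"
    proof (cases "0 < i \<and> i < p")
      case True
      hence "p dvd p choose i" using assms by (intro dvd_choose_prime) auto
      thus ?thesis using True by (simp add: f_def cong_0_iff)
    qed (auto simp: f_def not_less binomial_eq_0)
  qed
  also have "(\<Sum>i\<le>k. f i) = (\<Sum>i\<in>{..k} \<inter> {0, p}. f i)"
    by (rule sum.mono_neutral_right) (auto simp: f_def)
  also have "{..k} \<inter> {0, p} = (if p \<le> k then {0, p} else {0})" using p by auto
  also have "(\<Sum>i\<in>\<dots>. f i) = (n choose k) + (if p \<le> k then n choose (k - p) else 0)"
    using p by (simp add: f_def)
  finally show ?thesis .
qed

text \<open>Modulo \<open>p\<close>, adding \<open>p\<close> to the upper argument obeys the same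
  recursion in \<open>(n, j)\<close> as Pascal's rule, so induction on \<open>n\<close> carries the
  factor \<open>d choose e\<close> along unchanged.\<close>

lemma lucas_cong:
  fixes p n d j e :: nat
  assumes "prime p" "d < p" "e < p"
  shows "[(p * n + d) choose (p * j + e) = (n choose j) * (d choose e)] (mod p)"
proof (induction n arbitrary: j)
  case 0
  show ?case using assms by (cases j) (auto simp: binomial_eq_0)
next
  case (Suc n)
  have step: "[(p * Suc n + d) choose (p * j + e) = ((p * n + d) choose (p * j + e)) +
      (if p \<le> p * j + e then (p * n + d) choose (p * j + e - p) else 0)] (mod p)"
    using prime_add_choose_cong[OF assms(1), of "p * n + d" "p * j + e"] by (simp add: add_ac)
  show ?case
  proof (cases j)
    case 0
    \<comment> \<open>Here the lower argument is \<open>e < p\<close>, so the second summand in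
      \<open>step\<close> is 0.\<close>
    thus ?thesis using step Suc[of 0] assms by (auto intro: cong_trans)
  next
    case (Suc i)
    have "[((p * n + d) choose (p * j + e)) + ((p * n + d) choose (p * i + e)) =
        (n choose j) * (d choose e) + (n choose i) * (d choose e)] (mod p)"
      by (intro cong_add Suc.IH)
    also have "(n choose j) * (d choose e) + (n choose i) * (d choose e) = (Suc n choose j) * (d choose e)"
      by (simp add: Suc algebra_simps)
    finally show ?thesis using step by (auto simp: Suc intro: cong_trans)
  qed
qed

text \<open>Induction on the number of digits, splitting off the lowest digit \<open>d\<close> of
  \<open>x\<close>. By Lucas's theorem an index \<open>p * j + e\<close> is counted iff
  \<open>j\<close> is counted for the remaining digits and \<open>e \<le> p - 1 - d\<close>, which
  leaves \<open>p - d\<close> choices of \<open>e\<close>.\<close>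

lemma card_choose_complement_not_dvd:
  fixes p m x :: nat
  assumes "prime p" "x < p ^ m"
  shows "card {j. \<not> p dvd ((p ^ m - 1 - x) choose j)} = (\<Prod>l<m. p - x div p ^ l mod p)"
  using assms(2)
proof (induction m arbitrary: x)
  case 0
  have "\<not> p dvd (0 choose j) \<longleftrightarrow> j = 0" for j
    using assms(1) by (cases j) auto
  thus ?case using 0 by simp
next
  case (Suc m)
  have p: "p > 1" using assms(1) by (rule prime_gt_1_nat)
  define x' d where "x' = x div p" and "d = x mod p"
  have x: "x = p * x' + d" and d: "d < p" using p by (auto simp: x'_def d_def)
  have x': "x' < p ^ m" using Suc.prems p by (simp add: x'_def less_mult_imp_div_less mult.commute)
  define N where "N = p ^ m - 1 - x'"
  have "p ^ m = N + x' + 1" using x' by (simp add: N_def)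
  hence "p ^ Suc m = p * N + p * x' + p" by (simp add: algebra_simps)
  hence split: "p ^ Suc m - 1 - x = p * N + (p - 1 - d)" using d x by simp
  have nd: "\<not> p dvd ((p * N + (p - 1 - d)) choose (p * j + e)) \<longleftrightarrow>
      \<not> p dvd (N choose j) \<and> e \<le> p - 1 - d" if e: "e < p" for j e
  proof -
    \<comment> \<open>A nonzero binomial coefficient divides the factorial of its upper argument,
      here below \<open>p\<close>, so \<open>p\<close> can divide it only when it is 0.\<close>
    have "p dvd ((p - 1 - d) choose e) \<longleftrightarrow> \<not> e \<le> p - 1 - d"
    proof
      assume "p dvd ((p - 1 - d) choose e)"
      moreover have "((p - 1 - d) choose e) dvd fact (p - 1 - d)" if "e \<le> p - 1 - d"
        using binomial_fact_lemma[OF that] by (metis dvd_triv_right)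
      moreover have "\<not> p dvd fact (p - 1 - d)"
        using assms(1) p by (simp add: prime_dvd_fact_iff)
      ultimately show "\<not> e \<le> p - 1 - d" using dvd_trans by blast
    qed (simp add: binomial_eq_0)
    moreover have "p dvd ((p * N + (p - 1 - d)) choose (p * j + e)) \<longleftrightarrow>
        p dvd (N choose j) * ((p - 1 - d) choose e)"
      using assms(1) e p by (intro cong_dvd_iff lucas_cong) auto
    ultimately show ?thesis using assms(1) by (simp add: prime_dvd_mult_iff)
  qed
  have "bij_betw (\<lambda>(j, e). p * j + e) ({j. \<not> p dvd (N choose j)} \<times> {..p - 1 - d})
      {j. \<not> p dvd ((p ^ Suc m - 1 - x) choose j)}"
    unfolding split
  proof (rule bij_betw_byWitness[where f' = "\<lambda>k. (k div p, k mod p)"])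
    show "(\<lambda>k. (k div p, k mod p)) ` {j. \<not> p dvd ((p * N + (p - 1 - d)) choose j)}
        \<subseteq> {j. \<not> p dvd (N choose j)} \<times> {..p - 1 - d}"
    proof (rule image_subsetI)
      fix k assume "k \<in> {j. \<not> p dvd ((p * N + (p - 1 - d)) choose j)}"
      moreover have "k mod p < p" using p by simp
      ultimately show "(k div p, k mod p) \<in> {j. \<not> p dvd (N choose j)} \<times> {..p - 1 - d}"
        using nd[of "k mod p" "k div p"] by simp
    qed
    show "(\<lambda>(j, e). p * j + e) ` ({j. \<not> p dvd (N choose j)} \<times> {..p - 1 - d})
        \<subseteq> {j. \<not> p dvd ((p * N + (p - 1 - d)) choose j)}"
    proof (rule image_subsetI)
      fix z assume "z \<in> {j. \<not> p dvd (N choose j)} \<times> {..p - 1 - d}"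
      then obtain j e where z: "z = (j, e)" "\<not> p dvd (N choose j)" "e \<le> p - 1 - d" by auto
      moreover have "e < p" using z p by simp
      ultimately show "(case z of (j, e) \<Rightarrow> p * j + e) \<in>
          {j. \<not> p dvd ((p * N + (p - 1 - d)) choose j)}"
        using nd[of e j] by simp
    qed
  qed (use p in auto)
  hence "card {j. \<not> p dvd ((p ^ Suc m - 1 - x) choose j)} =
      card {j. \<not> p dvd (N choose j)} * (p - d)"
    using d by (simp add: bij_betw_same_card[symmetric] card_cartesian_product Suc_diff_Suc
      del: mult_Suc_right)
  also have "card {j. \<not> p dvd (N choose j)} = (\<Prod>l<m. p - x' div p ^ l mod p)"
    unfolding N_def using x' by (rule Suc.IH)
  also have "\<dots> * (p - d) = (\<Prod>l<Suc m. p - x div p ^ l mod p)"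
    unfolding prod.lessThan_Suc_shift by (simp add: x'_def d_def div_mult2_eq)
  finally show ?case .
qed

text \<open>Groups the digit positions by digit value. The value \<open>p - 1\<close> contributes
  only factors 1, so the product may stop at \<open>p - 2\<close>.\<close>

lemma t_number_eq_prod_digits:
  assumes "prime p"
  shows "t_number p a = (\<Prod>l<min_exp p a. p - (a - 1) div p ^ l mod p)"
proof -
  define D where "D l = (a - 1) div p ^ l mod p" for l
  have p: "p \<ge> 2" using assms by (rule prime_ge_2_nat)
  have "(\<Prod>l<min_exp p a. p - D l) =
      (\<Prod>j\<in>{..<p}. \<Prod>l\<in>{l \<in> {..<min_exp p a}. D l = j}. p - D l)"
    using p by (intro prod.group[symmetric]) (auto simp: D_def)
  also have "\<dots> = (\<Prod>j<p. (p - j) ^ digit_count p a j)"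
    by (simp add: digit_count_def D_def cong: conj_cong)
  also have "\<dots> = (\<Prod>j = 0..p - 2. (p - j) ^ digit_count p a j)"
  proof (rule prod.mono_neutral_right)
    show "\<forall>j\<in>{..<p} - {0..p - 2}. (p - j) ^ digit_count p a j = 1"
    proof
      fix j assume "j \<in> {..<p} - {0..p - 2}"
      hence "p - j = 1" by auto
      thus "(p - j) ^ digit_count p a j = 1" by simp
    qed
  qed (use p in auto)
  finally show ?thesis by (simp add: t_number_def D_def)
qed


section \<open>Sums over pairs of monic linear polynomials, and the shift identity for one
  pair\<close>

lemma S1_eq_sum_translates:
  "S1 (int k) = (\<Sum>c::'a::{field,finite}\<in>UNIV. inverse (to_fract [:c, 1:]) ^ k)"
proof -
  have "{n :: 'a poly. lead_coeff n = 1 \<and> degree n = 1} = range (\<lambda>c. [:c, 1:])"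
  proof (intro subset_antisym subsetI)
    fix n :: "'a poly" assume "n \<in> {n. lead_coeff n = 1 \<and> degree n = 1}"
    hence n: "lead_coeff n = 1" "degree n = 1" by auto
    then obtain c d where "n = [:c, d:]" by (metis degree1_coeffs)
    thus "n \<in> range (\<lambda>c. [:c, 1:])" using n by (cases "d = 0") auto
  qed auto
  moreover have "inj (\<lambda>c :: 'a. [:c, 1:])" by (auto simp: inj_on_def)
  ultimately show ?thesis
    unfolding S1_def by (simp add: sum.reindex power_int_minus power_inverse)
qed

text \<open>Indexes pairs by the difference \<open>e\<close> of second and first entry. For
  \<open>Delta\<close> the diagonal \<open>e = 0\<close> is the part equal to
  \<open>S1 (a + b)\<close>, which the definition subtracts.\<close>

lemma sum_off_diagonal_eq:
  fixes f :: "'a::{ab_group_add,finite} \<Rightarrow> 'a \<Rightarrow> 'b::comm_ring_1"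
  shows "(\<Sum>c\<in>UNIV. \<Sum>d\<in>UNIV. f c d) =
    (\<Sum>c\<in>UNIV. f c c) + (\<Sum>e\<in>UNIV-{0}. \<Sum>c\<in>UNIV. f (c - e) c)"
proof -
  have "(\<Sum>c\<in>UNIV. \<Sum>d\<in>UNIV. f c d) = (\<Sum>d\<in>UNIV. \<Sum>c\<in>UNIV. f c d)"
    by (rule sum.swap)
  also have "\<dots> = (\<Sum>d\<in>UNIV. \<Sum>e\<in>UNIV. f (d - e) d)"
  proof (rule sum.cong)
    fix d :: 'a
    show "(\<Sum>c\<in>UNIV. f c d) = (\<Sum>e\<in>UNIV. f (d - e) d)"
      by (rule sum.reindex_bij_witness[of _ "\<lambda>e. d - e" "\<lambda>c. d - c"]) auto
  qed simp
  also have "\<dots> = (\<Sum>e\<in>UNIV. \<Sum>c\<in>UNIV. f (c - e) c)" by (rule sum.swap)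
  also have "\<dots> = (\<Sum>c\<in>UNIV. f c c) + (\<Sum>e\<in>UNIV-{0}. \<Sum>c\<in>UNIV. f (c - e) c)"
    by (subst sum.remove[of _ 0]) auto
  finally show ?thesis .
qed

lemma Delta_eq_sum:
  "Delta a b = (\<Sum>e\<in>UNIV-{0::'a::{field,finite}}. \<Sum>c\<in>UNIV.
     inverse (to_fract [:c - e, 1:]) ^ a * inverse (to_fract [:c, 1:]) ^ b)"
proof -
  have "S1 (int a) * S1 (int b) = (\<Sum>c::'a\<in>UNIV. \<Sum>d\<in>UNIV.
      inverse (to_fract [:c, 1:]) ^ a * inverse (to_fract [:d, 1:]) ^ b)"
    unfolding S1_eq_sum_translates by (simp add: sum_product)
  thus ?thesis
    unfolding Delta_def S1_eq_sum_translates sum_off_diagonal_eq by (simp add: power_add)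
qed

lemma inverse_power_shift_diff:
  fixes x e :: "'b::field"
  assumes "prime CHAR('b)" "M = CHAR('b) ^ m" "a \<le> M"
    and "x \<noteq> 0" "x \<noteq> e" "e ^ n = 1"
  shows "inverse (x - e) ^ a * inverse x ^ (b + n * M) - inverse (x - e) ^ a * inverse x ^ b =
    - (\<Sum>j\<le>M - a. \<Sum>i<n. (-1) ^ j * of_nat ((M - a) choose j) * e ^ (j + i * M) *
         inverse x ^ (a + b + j + i * M))"
proof -
  define y where "y = x - e"
  have y0: "y \<noteq> 0" using assms by (simp add: y_def)
  have cancel: "inverse x ^ k * x ^ l = inverse x ^ (k - l)" if "l \<le> k" for k l
    using that assms(4) by (simp add: power_diff power_inverse field_simps)
  have "x ^ M = y ^ M + e ^ M"
    using freshmans_dream'[OF assms(1,2), of y e] by (simp add: y_def)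
  hence yM: "y ^ M = x ^ M - e ^ M" by simp
  \<comment> \<open>Since \<open>e ^ n = 1\<close>, the 1 may be written as
    \<open>(e ^ M) ^ n\<close>; a difference of \<open>n\<close>-th powers is then divisible by
    \<open>x ^ M - e ^ M = y ^ M\<close>.\<close>
  have "x ^ (n * M) - 1 = (x ^ M) ^ n - (e ^ M) ^ n"
    using assms(6) by (metis mult.commute power_mult power_one)
  also have "\<dots> = y ^ M * (\<Sum>i<n. (x ^ M) ^ (n - Suc i) * (e ^ M) ^ i)"
    using power_diff_sumr2[of "e ^ M" n "x ^ M"] unfolding yM by (simp add: algebra_simps)
  finally have one: "x ^ (n * M) - 1 = y ^ M * (\<Sum>i<n. x ^ (M * (n - Suc i)) * e ^ (i * M))"
    by (simp add: mult.commute flip: power_mult)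
  have "inverse y ^ a * y ^ M = y ^ (M - a)"
    using y0 assms(3) by (simp add: power_diff power_inverse field_simps)
  also have "\<dots> = (\<Sum>j\<le>M - a. (-1) ^ j * of_nat ((M - a) choose j) * e ^ j * x ^ (M - a - j))"
    using binomial_ring[of "- e" x "M - a"] by (simp add: y_def power_minus[of e] mult_ac)
  finally have two: "inverse y ^ a * y ^ M = \<dots>" .
  have three: "inverse x ^ (b + n * M) * (x ^ (M - a - j) * x ^ (M * (n - Suc i))) =
      inverse x ^ (a + b + j + i * M)" if "j \<le> M - a" "i < n" for i j
  proof -
    \<comment> \<open>Replaces the truncated difference \<open>n - Suc i\<close> by
      \<open>k\<close>; the exponents then add up exactly because \<open>j \<le> M - a\<close> and
      \<open>a \<le> M\<close>.\<close>
    obtain k where n: "n = Suc (i + k)" using \<open>i < n\<close> by (elim less_natE)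
    have "b + n * M = (a + b + j + i * M) + (M - a - j + M * (n - Suc i))"
      using that(1) assms(3) by (simp add: n algebra_simps)
    moreover have "inverse x ^ (k + l) * x ^ l = inverse x ^ k" for k l
      using cancel[of l "k + l"] by simp
    ultimately show ?thesis by (simp only: power_add[symmetric])
  qed
  have "inverse y ^ a * inverse x ^ b = inverse y ^ a * inverse x ^ (b + n * M) * x ^ (n * M)"
    by (simp add: cancel mult.assoc)
  hence "inverse y ^ a * inverse x ^ (b + n * M) - inverse y ^ a * inverse x ^ b =
      - (inverse x ^ (b + n * M) * (inverse y ^ a * (x ^ (n * M) - 1)))"
    by (simp add: right_diff_distrib mult_ac)
  also have "inverse y ^ a * (x ^ (n * M) - 1) =
      (inverse y ^ a * y ^ M) * (\<Sum>i<n. x ^ (M * (n - Suc i)) * e ^ (i * M))"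
    unfolding one by (rule mult.assoc[symmetric])
  also have "\<dots> =
      (\<Sum>j\<le>M - a. \<Sum>i<n. ((-1) ^ j * of_nat ((M - a) choose j) * e ^ j * x ^ (M - a - j)) *
        (x ^ (M * (n - Suc i)) * e ^ (i * M)))"
    unfolding two by (rule sum_product)
  also have "inverse x ^ (b + n * M) * \<dots> =
      (\<Sum>j\<le>M - a. \<Sum>i<n. (-1) ^ j * of_nat ((M - a) choose j) * e ^ (j + i * M) *
         inverse x ^ (a + b + j + i * M))"
    unfolding sum_distrib_left
  proof (intro sum.cong refl)
    fix j i assume "j \<in> {..M - a}" "i \<in> {..<n}"
    hence "inverse x ^ (b + n * M) * (x ^ (M - a - j) * x ^ (M * (n - Suc i))) =
      inverse x ^ (a + b + j + i * M)" by (intro three) auto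
    thus "inverse x ^ (b + n * M) * ((-1) ^ j * of_nat ((M - a) choose j) * e ^ j * x ^ (M - a - j) *
        (x ^ (M * (n - Suc i)) * e ^ (i * M))) =
      (-1) ^ j * of_nat ((M - a) choose j) * e ^ (j + i * M) * inverse x ^ (a + b + j + i * M)"
      by (simp only: power_add mult_ac)
  qed
  finally show ?thesis unfolding y_def .
qed

section \<open>Passage to the field of rational functions\<close>

lemma to_fract_power: "to_fract (x ^ n) = to_fract x ^ n"
  by (induction n) auto

lemma to_fract_of_nat: "to_fract (of_nat n) = of_nat n"
  by (induction n) auto

text \<open>The embedding \<open>to_fract\<close> is injective, so a multiple of 1 vanishes in both
  rings or in neither. This makes \<open>inverse_power_shift_diff\<close> applicable to rational
  functions over \<open>'a\<close>.\<close>

lemma CHAR_fract: "CHAR('b::idom fract) = CHAR('b)"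
proof (rule CHAR_eqI)
  have of_nat_eq_0: "(of_nat k :: 'b fract) = 0 \<longleftrightarrow> CHAR('b) dvd k" for k
    unfolding to_fract_of_nat[symmetric] to_fract_eq_0_iff by (rule of_nat_eq_0_iff_char_dvd)
  show "of_nat CHAR('b) = (0 :: 'b fract)" by (simp only: of_nat_eq_0 dvd_refl)
  show "CHAR('b) dvd k" if "of_nat k = (0 :: 'b fract)" for k
    using that by (simp only: of_nat_eq_0)
qed

lemma le_power_min_exp:
  assumes "p > 1"
  shows "a \<le> p ^ min_exp p a"
  unfolding min_exp_def
  by (rule LeastI[of _ a]) (use power_gt_expt[of p a] assms in simp)

lemma CHAR_eq_of_card_eq_prime_power:
  assumes "prime p" "card (UNIV :: 'a::{field,finite} set) = p ^ s"
  shows "CHAR('a) = p"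
proof -
  have "prime CHAR('a)" by (intro prime_CHAR_semidom finite_imp_CHAR_pos) simp
  moreover have "CHAR('a) dvd p ^ s" using CHAR_dvd_CARD[where ?'a = 'a] assms(2) by simp
  ultimately show ?thesis using assms(1) by (metis prime_dvd_power primes_dvd_imp_eq)
qed

text \<open>Sums the one-pair identity over all pairs. The inner sum stays over a set of exponents
  \<open>i\<close>; uniqueness of the index in \<open>i_index_ex1\<close> later reduces it to one
  term.\<close>

lemma Delta_shift_diff:
  fixes a b m :: nat
  defines "M \<equiv> CHAR('a::{field,finite}) ^ m"
    and "n \<equiv> card (UNIV :: 'a set) - 1"
  assumes "a \<le> M"
  shows "(Delta a (b + n * M) - Delta a b :: 'a poly fract) =
    (\<Sum>j\<le>M - a. \<Sum>i | i < n \<and> n dvd j + i * M.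
      to_fract [:(-1) ^ j * of_nat ((M - a) choose j):] * S1 (int (a + b + j + i * M)))"
proof -
  define C :: "'a \<Rightarrow> 'a poly fract" where "C c = to_fract [:c:]" for c
  define X :: "'a \<Rightarrow> 'a poly fract" where "X c = to_fract [:c, 1:]" for c
  have prime: "prime CHAR('a)" by (intro prime_CHAR_semidom finite_imp_CHAR_pos) simp
  have C_power: "C c ^ k = C (c ^ k)" for c k
    by (simp add: C_def poly_const_pow flip: to_fract_power)
  have C_mult: "C c * C d = C (c * d)" for c d
    by (simp add: C_def flip: to_fract_mult)
  have C_sum: "(\<Sum>c\<in>A. C (f c)) = C (\<Sum>c\<in>A. f c)" for A and f :: "'a \<Rightarrow> 'a"
    by (induction A rule: infinite_finite_induct) (auto simp: C_def simp flip: to_fract_add)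
  have "[:- 1:] = (- 1 :: 'a poly)" by (metis minus_pCons minus_zero pCons_one)
  hence C_minus_one: "C (-1) = -1" by (simp add: C_def)
  have C_coeff: "C ((-1) ^ j * of_nat k) = (-1) ^ j * of_nat k" for j k
  proof -
    have "C (of_nat k) = of_nat k" by (simp add: C_def flip: of_nat_poly to_fract_of_nat)
    thus ?thesis by (simp flip: C_mult C_power add: C_minus_one)
  qed
  have swap: "(\<Sum>c\<in>A. \<Sum>j\<in>J. \<Sum>i\<in>I. g c j i) = (\<Sum>j\<in>J. \<Sum>i\<in>I. \<Sum>c\<in>A. g c j i)"
    for A :: "'a set" and J I :: "nat set" and g :: "'a \<Rightarrow> nat \<Rightarrow> nat \<Rightarrow> 'a poly fract"
    by (subst sum.swap) (intro sum.cong refl sum.swap)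
  have X_diff: "X (c - e) = X c - C e" for c e
    by (simp add: X_def C_def flip: to_fract_diff)
  have term_eq: "inverse (X (c - e)) ^ a * inverse (X c) ^ (b + n * M) -
        inverse (X (c - e)) ^ a * inverse (X c) ^ b =
      - (\<Sum>j\<le>M - a. \<Sum>i<n. C ((-1) ^ j * of_nat ((M - a) choose j)) * C (e ^ (j + i * M)) *
           inverse (X c) ^ (a + b + j + i * M))" if "e \<noteq> 0" for c e
    unfolding X_diff C_coeff C_power[symmetric]
  proof (rule inverse_power_shift_diff)
    show "C e ^ n = 1"
      unfolding C_power n_def using power_card_units_eq_1[OF that] by (simp add: C_def pCons_one)
    show "X c \<noteq> C e" by (simp add: X_def C_def)
  qed (use assms prime in \<open>auto simp: CHAR_fract X_def\<close>)
  have S1_X: "S1 (int k) = (\<Sum>c\<in>UNIV. inverse (X c) ^ k)" for k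
    unfolding X_def by (rule S1_eq_sum_translates)
  have "Delta a (b + n * M) - Delta a b = (\<Sum>e\<in>UNIV-{0}. \<Sum>c\<in>UNIV.
      - (\<Sum>j\<le>M - a. \<Sum>i<n. C ((-1) ^ j * of_nat ((M - a) choose j)) * C (e ^ (j + i * M)) *
           inverse (X c) ^ (a + b + j + i * M)))"
    unfolding Delta_eq_sum sum_subtractf[symmetric] X_def[symmetric]
    by (intro sum.cong refl term_eq) auto
  also have "\<dots> = - (\<Sum>e\<in>UNIV-{0}. \<Sum>j\<le>M - a. \<Sum>i<n.
      C ((-1) ^ j * of_nat ((M - a) choose j)) * C (e ^ (j + i * M)) * S1 (int (a + b + j + i * M)))"
    unfolding sum_negf S1_X sum_distrib_left by (subst swap) (rule refl)
  \<comment> \<open>With the sum over \<open>e\<close> innermost, \<open>sum_power_units\<close>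
    applies; its value -1 cancels the sign from the one-pair identity.\<close>
  also have "\<dots> = (\<Sum>j\<le>M - a. \<Sum>i<n. - (C ((-1) ^ j * of_nat ((M - a) choose j)) *
      (\<Sum>e\<in>UNIV-{0}. C (e ^ (j + i * M))) * S1 (int (a + b + j + i * M))))"
    unfolding sum_negf sum_distrib_left sum_distrib_right by (subst swap) (rule refl)
  also have "\<dots> = (\<Sum>j\<le>M - a. \<Sum>i<n. if n dvd j + i * M
      then C ((-1) ^ j * of_nat ((M - a) choose j)) * S1 (int (a + b + j + i * M)) else 0)"
    unfolding C_sum sum_power_units n_def[symmetric]
    by (intro sum.cong refl) (simp add: C_minus_one, simp add: C_def)
  also have "\<dots> = (\<Sum>j\<le>M - a. \<Sum>i | i < n \<and> n dvd j + i * M.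
      C ((-1) ^ j * of_nat ((M - a) choose j)) * S1 (int (a + b + j + i * M)))"
    by (intro sum.cong refl sum.mono_neutral_cong_right) auto
  finally show ?thesis unfolding C_def .
qed

theorem theorem5p13:
  fixes p s q a b m :: nat
  assumes "prime p"
    and "q = p ^ s"
    and "card (UNIV :: 'a::{field,finite} set) = q"
    and "a > 0"
    and "b > 0"
    and "m = min_exp p a"
  shows "(Delta a (b + r_shift p q a) - Delta a b :: 'a poly fract) =
           (\<Sum>j = 0..p ^ m - a.
              to_fract [:f_coeff p a j:] * S1 (int (a + b + j + i_index p q a j * p ^ m)))
         \<and> card {j \<in> {0..p ^ m - a}. (f_coeff p a j :: 'a) \<noteq> 0} = t_number p a"
proof
  have CHAR: "CHAR('a) = p" using CHAR_eq_of_card_eq_prime_power assms(1-3) by blast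
  have a_le: "a \<le> p ^ m" using le_power_min_exp assms(1,6) prime_gt_1_nat by blast
  \<comment> \<open>A field has at least two elements, which excludes
    \<open>q = p ^ 0 = 1\<close>.\<close>
  have "s > 0" using card_units_pos[where ?'a = 'a] assms(2,3) by (intro gr0I) simp
  hence ex1: "\<exists>!i. i < q - 1 \<and> [j + i * p ^ m = 0] (mod (q - 1))" for j
    unfolding assms(6) using assms(1,2) i_index_ex1 by blast
  have "{i. i < q - 1 \<and> q - 1 dvd j + i * p ^ m} = {i_index p q a j}" for j
    using theI'[OF ex1[of j]] ex1[of j] unfolding i_index_def assms(6)[symmetric] cong_0_iff by blast
  with Delta_shift_diff[where ?'a = 'a, of a m b]
  show "(Delta a (b + r_shift p q a) - Delta a b :: 'a poly fract) =
      (\<Sum>j = 0..p ^ m - a.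
         to_fract [:f_coeff p a j:] * S1 (int (a + b + j + i_index p q a j * p ^ m)))"
    using a_le by (simp add: CHAR assms(3) r_shift_def f_coeff_def atLeast0AtMost flip: assms(6))
  have "(f_coeff p a j :: 'a) \<noteq> 0 \<longleftrightarrow> \<not> p dvd ((p ^ m - a) choose j)" for j
    using CHAR by (simp add: f_coeff_def of_nat_eq_0_iff_char_dvd flip: assms(6))
  moreover have "j \<le> p ^ m - a" if "\<not> p dvd ((p ^ m - a) choose j)" for j
    using that by (intro leI notI) (simp add: binomial_eq_0)
  ultimately have "card {j \<in> {0..p ^ m - a}. (f_coeff p a j :: 'a) \<noteq> 0} =
      card {j. \<not> p dvd ((p ^ m - a) choose j)}"
    by (intro arg_cong[of _ _ card]) auto
  \<comment> \<open>Since \<open>a > 0\<close>, \<open>p ^ m - a = p ^ m - 1 - (a - 1)\<close> and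
    \<open>a - 1 < p ^ m\<close>, so the digit count applies with \<open>x = a - 1\<close>.\<close>
  also have "card {j. \<not> p dvd ((p ^ m - a) choose j)} = (\<Prod>l<m. p - (a - 1) div p ^ l mod p)"
    using card_choose_complement_not_dvd[of p "a - 1" m] assms(1,4) a_le by simp
  also have "\<dots> = t_number p a" using t_number_eq_prod_digits assms(1,6) by simp
  finally show "card {j \<in> {0..p ^ m - a}. (f_coeff p a j :: 'a) \<noteq> 0} = t_number p a" .
qed

end
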